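(* There is an absolute constant $c > 0$ such that for all sufficiently large positive integers $n$, $$P(n) \ge c\,\frac{\log n}{\log\log n}.$$
   Context: For positive integers $a, n$, define a sequence by $a_0 := a$ and, for $j \ge 0$ (as long as $a_j > 0$), $a_{j+1} := n \pmod{a_j} \in \{0,1,\dots,a_j-1\}$, i.e. $a_{j+1}$ is the remainder of $n$ upon division by $a_j$. Define $P(a,n)$ to be the first positive integer $k$ such that $a_k = 0$, and set $P(n) := \max_{1 \le a \le n} P(a,n)$. *)

theory Defs
  imports Complex_Main
begin

text \<open>
  Since \<open>n mod 0 = n\<close> in HOL, the sequence restarts with the value \<open>n\<close> after it has reached
  \<open>0\<close>. These terms carry no meaning and do not affect the index of the first zero.
\<close>
primrec remainder_seq :: "nat \<Rightarrow> nat \<Rightarrow> nat \<Rightarrow> nat" where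
  "remainder_seq a n 0 = a"
| "remainder_seq a n (Suc j) = n mod remainder_seq a n j"

definition pierce_length :: "nat \<Rightarrow> nat \<Rightarrow> nat" where
  "pierce_length a n = (LEAST k. 0 < k \<and> remainder_seq a n k = 0)"

definition max_pierce_length :: "nat \<Rightarrow> nat" where
  "max_pierce_length n = Max ((\<lambda>a. pierce_length a n) ` {1..n})"

lemma ex_remainder_seq_eq_0:
  assumes "0 < a"
  shows "\<exists>k>0. remainder_seq a n k = 0"
proof (rule ccontr)
  assume "\<not> ?thesis"
  then have pos: "0 < remainder_seq a n k" for k
    using assms by (cases k) auto
  have "remainder_seq a n k + k \<le> a" for k
  proof (induction k)
    case (Suc k)
    have "remainder_seq a n (Suc k) < remainder_seq a n k"
      using pos[of k] by simp
    with Suc.IH show ?case by linarith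
  qed simp
  from this[of "Suc a"] show False by simp
qed

lemma pierce_length_works:
  assumes "0 < a"
  shows "0 < pierce_length a n" and "remainder_seq a n (pierce_length a n) = 0"
    and "\<And>k. 0 < k \<Longrightarrow> k < pierce_length a n \<Longrightarrow> 0 < remainder_seq a n k"
proof -
  have "0 < pierce_length a n \<and> remainder_seq a n (pierce_length a n) = 0"
    unfolding pierce_length_def by (rule LeastI_ex[OF ex_remainder_seq_eq_0[OF assms]])
  then show "0 < pierce_length a n" and "remainder_seq a n (pierce_length a n) = 0"
    by simp_all
next
  fix k
  assume "0 < k" and "k < pierce_length a n"
  moreover from this(2) have "\<not> (0 < k \<and> remainder_seq a n k = 0)"
    unfolding pierce_length_def by (rule not_less_Least)
  ultimately show "0 < remainder_seq a n k"
    by simp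
qed

end

theory Submission
  imports Defs "HOL-Real_Asymp.Real_Asymp"
begin

text \<open>
  If \<open>x\<close> lies in \<open>(n/(j+2), n/(j+1))\<close>, then \<open>n\<close> contains \<open>x\<close> exactly \<open>j+1\<close> times, and the
  remainder is \<open>n - (j+1) x\<close>. So it suffices to find an integer \<open>a\<close> for which the quotients along
  the remainder sequence are \<open>1, 2, \<dots>, k\<close>, the smallest strictly increasing choice (for large \<open>n\<close>
  this puts \<open>a/n\<close> close to \<open>1 - 1/e\<close>).

  While the quotients are prescribed in this way, the \<open>j\<close>-th remainder is an affine function of
  \<open>a\<close> with slope \<open>\<plusminus>j!\<close> (\<open>affine_remainder_eq\<close>). Two facts make the construction work. The
  condition that \<open>a\<^sub>j\<close> lies in \<open>(n/(j+2), n/(j+1))\<close> is inherited backwards, so only the last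
  remainder has to be controlled (\<open>affine_remainder_in_interval_pred\<close>). And the interval for
  \<open>a\<^sub>k\<close> has length \<open>n/((k+1)(k+2))\<close>, so its preimage under an affine map of slope \<open>\<plusminus>k!\<close> has length
  \<open>n/(k+2)!\<close> and contains an integer \<open>a\<close> once \<open>(k+2)! < n\<close>. This yields \<open>P(n) > k\<close> whenever
  \<open>(k+2)! < n\<close> (\<open>max_pierce_length_gt_if_fact_less\<close>).

  Since \<open>m! \<le> m\<^sup>m\<close>, the number \<open>m = \<lfloor>log n / log log n\<rfloor>\<close> satisfies \<open>m! < n\<close>, and \<open>k = m - 2\<close> gives
  the bound with the constant \<open>1/2\<close>.
\<close>

text \<open>
  The remainder sequence started at a real number, under the assumption that the successive
  quotients are \<open>1, 2, 3, \<dots>\<close>.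
\<close>
primrec affine_remainder :: "real \<Rightarrow> nat \<Rightarrow> real \<Rightarrow> real" where
  "affine_remainder n 0 x = x"
| "affine_remainder n (Suc j) x = n - (real j + 1) * affine_remainder n j x"

definition quotient_interval :: "real \<Rightarrow> nat \<Rightarrow> real set" where
  "quotient_interval n j = {n / (real j + 2)<..<n / (real j + 1)}"

lemma affine_remainder_eq:
  "affine_remainder n j x = affine_remainder n j 0 + (-1) ^ j * fact j * x"
proof (induction j)
  case (Suc j)
  show ?case
    unfolding affine_remainder.simps Suc.IH by (simp add: algebra_simps)
qed simp

text \<open>
  The inverse step \<open>y \<mapsto> (n - y)/(j+1)\<close> maps the interval for \<open>j+1\<close> into the interval for \<open>j\<close>: the
  endpoint \<open>n/(j+2)\<close> is a fixed point of it, and the endpoint \<open>n/(j+3)\<close> goes to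
  \<open>n(j+2)/((j+1)(j+3)) < n/(j+1)\<close>.
\<close>
lemma affine_remainder_in_interval_pred:
  assumes "0 < n" and "affine_remainder n (Suc j) x \<in> quotient_interval n (Suc j)"
  shows "affine_remainder n j x \<in> quotient_interval n j"
proof -
  let ?y = "affine_remainder n j x"
  have pos: "0 < n / (real j + 3)"
    using assms(1) by (intro divide_pos_pos) auto
  have lower: "n / (real j + 3) < n - (real j + 1) * ?y"
    and upper: "n - (real j + 1) * ?y < n / (real j + 2)"
    using assms(2) by (simp_all add: quotient_interval_def add.commute add.left_commute)
  have "(real j + 1) * ?y < n"
    using pos lower by linarith
  then have "?y < n / (real j + 1)"
    by (simp add: pos_less_divide_eq mult.commute)
  moreover have "n / (real j + 2) < ?y"
  proof -
    have "(real j + 1) * (n / (real j + 2)) = n - n / (real j + 2)"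
      by (simp add: field_simps)
    also have "\<dots> < (real j + 1) * ?y"
      using upper by linarith
    finally show ?thesis
      by (simp add: mult_less_cancel_left_pos del: times_divide_eq_right)
  qed
  ultimately show ?thesis
    by (simp add: quotient_interval_def)
qed

lemma affine_remainder_in_interval_le:
  assumes "0 < n" and "affine_remainder n k x \<in> quotient_interval n k" and "j \<le> k"
  shows "affine_remainder n j x \<in> quotient_interval n j"
  using assms(3) by (induction rule: inc_induct)
    (use assms(1,2) affine_remainder_in_interval_pred in auto)

lemma mod_eq_if_in_quotient_interval:
  fixes n r :: nat
  assumes "real r \<in> quotient_interval (real n) j"
  shows "real (n mod r) = real n - (real j + 1) * real r"
proof -
  have "real n < (real j + 2) * real r" and "(real j + 1) * real r < real n"
    using assms by (simp_all add: quotient_interval_def field_simps)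
  then have "real n < real ((j + 2) * r)" and "real ((j + 1) * r) < real n"
    by (simp_all only: of_nat_add of_nat_mult of_nat_numeral of_nat_1)
  then have less: "n < (j + 2) * r" and le: "(j + 1) * r \<le> n"
    by (simp_all only: of_nat_less_iff less_imp_le)
  have "n div r = j + 1"
    using less le by (intro div_nat_eqI) (simp_all add: algebra_simps)
  then have "n = (j + 1) * r + n mod r"
    by (metis mult_div_mod_eq mult.commute)
  then have "real n = real ((j + 1) * r + n mod r)"
    by (rule arg_cong)
  then show ?thesis
    by (simp only: of_nat_add of_nat_mult of_nat_1)
qed

lemma remainder_seq_eq_affine_remainder:
  assumes "\<And>i. i < j \<Longrightarrow>
      affine_remainder (real n) i (real a) \<in> quotient_interval (real n) i"
  shows "real (remainder_seq a n j) = affine_remainder (real n) j (real a)"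
  using assms
proof (induction j)
  case (Suc j)
  then have eq: "real (remainder_seq a n j) = affine_remainder (real n) j (real a)"
    by simp
  with Suc.prems[of j] show ?case
    using mod_eq_if_in_quotient_interval[of "remainder_seq a n j" n j] by simp
qed simp

lemma pierce_length_gt_if_in_interval:
  assumes "0 < n" and "0 < a"
    and "affine_remainder (real n) k (real a) \<in> quotient_interval (real n) k"
  shows "k < pierce_length a n"
proof (rule ccontr)
  let ?l = "pierce_length a n"
  assume "\<not> k < ?l"
  then have l: "?l \<le> k"
    by simp
  have mem: "affine_remainder (real n) i (real a) \<in> quotient_interval (real n) i"
    if "i \<le> k" for i
    using affine_remainder_in_interval_le assms(1,3) that by simp
  have "real (remainder_seq a n ?l) = affine_remainder (real n) ?l (real a)"
    using l by (intro remainder_seq_eq_affine_remainder mem) simp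
  moreover have "0 < real n / (real ?l + 2)"
    using assms(1) by (intro divide_pos_pos) auto
  then have "0 < affine_remainder (real n) ?l (real a)"
    using mem[OF l] by (auto simp: quotient_interval_def)
  ultimately show False
    using pierce_length_works(2)[OF assms(2), of n] by simp
qed

lemma ex_int_affine_in_open_interval:
  fixes d e s u v :: real
  assumes "0 < d" and "s = 1 \<or> s = -1" and "d < v - u"
  shows "\<exists>z::int. e + s * d * of_int z \<in> {u<..<v}"
proof -
  define m where "m = \<lfloor>(u - e) / d\<rfloor> + 1"
  have "(u - e) / d < of_int m" and "of_int m \<le> (u - e) / d + 1"
    unfolding m_def by linarith+
  then have "u - e < d * of_int m" and "d * of_int m \<le> u - e + d"
    using assms(1) by (simp_all add: field_simps)
  then have "e + d * of_int m \<in> {u<..<v}"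
    using assms(3) by simp
  then have "e + s * d * of_int (if s = 1 then m else - m) \<in> {u<..<v}"
    using assms(2) by auto
  then show ?thesis
    by blast
qed

lemma max_pierce_length_gt_if_fact_less:
  assumes "fact (k + 2) < n"
  shows "k < max_pierce_length n"
proof -
  have n: "0 < n"
    using assms by simp
  have "(real k + 2) * ((real k + 1) * fact k) = real (fact (Suc (Suc k)))"
    by (simp only: fact_Suc of_nat_mult of_nat_Suc of_nat_fact) (simp add: add.commute)
  also have "\<dots> < real n"
    using assms by (simp only: of_nat_less_iff add_2_eq_Suc')
  finally have "(real k + 2) * ((real k + 1) * fact k) < real n" .
  then have "(fact k :: real) < real n / ((real k + 2) * (real k + 1))"
    by (simp add: pos_less_divide_eq mult_ac)
  also have "\<dots> = real n / (real k + 1) - real n / (real k + 2)"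
    by (simp add: field_simps)
  finally obtain z :: int where z:
    "affine_remainder (real n) k 0 + (-1) ^ k * fact k * of_int z
      \<in> quotient_interval (real n) k"
    unfolding quotient_interval_def
    using ex_int_affine_in_open_interval[of "fact k" "(-1) ^ k"]
      neg_one_even_power[of k] neg_one_odd_power[of k] by (metis fact_gt_zero)
  then have mem: "affine_remainder (real n) k (of_int z) \<in> quotient_interval (real n) k"
    by (subst affine_remainder_eq)
  \<comment> \<open>For index \<open>0\<close> the interval is \<open>(n/2, n)\<close>, so the integer found is an admissible start.\<close>
  have "real_of_int z \<in> quotient_interval (real n) 0"
    using affine_remainder_in_interval_le[OF _ mem, of 0] n by simp
  then have "real n / 2 < of_int z" and "of_int z < real n"
    by (simp_all add: quotient_interval_def)
  then have "0 < z" and "z < int n"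
    using n by linarith+
  then obtain a where a: "z = int a" "0 < a" "a < n"
    by (metis zero_less_imp_eq_int of_nat_less_iff)
  have "k < pierce_length a n"
    using mem a n by (intro pierce_length_gt_if_in_interval) simp_all
  also have "pierce_length a n \<le> max_pierce_length n"
    unfolding max_pierce_length_def using a by (intro Max_ge) auto
  finally show ?thesis .
qed

text \<open>
  With \<open>L = log n\<close> the hypothesis \<open>m \<le> L / log L\<close> gives
  \<open>m log m < m log L \<le> L\<close>, that is, \<open>m\<^sup>m < n\<close>.
\<close>
lemma fact_less_if_le_ln_div_ln_ln:
  fixes m n :: nat
  assumes "0 < m" and "0 < n" and "1 < ln (ln (real n))"
    and "real m \<le> ln (real n) / ln (ln (real n))"
  shows "fact m < n"
proof -
  define L where "L = ln (real n)"
  have lnL: "1 < ln L" and m_le: "real m \<le> L / ln L"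
    using assms(3,4) by (simp_all add: L_def)
  have mL: "real m * ln L \<le> L"
    using lnL m_le by (simp add: pos_le_divide_eq)
  have "real m < real m * ln L"
    using lnL assms(1) by simp
  with mL have "real m < L"
    by linarith
  then have "ln (real m) < ln L"
    using assms(1) by simp
  then have "real m * ln (real m) < real m * ln L"
    using assms(1) by simp
  with mL have "real m * ln (real m) < ln (real n)"
    by (simp add: L_def)
  then have "ln (real m ^ m) < ln (real n)"
    using assms(1) by (simp add: ln_realpow)
  then have "real (m ^ m) < real n"
    using assms(1,2) by simp
  then have "m ^ m < n"
    by (simp only: of_nat_less_iff)
  then show ?thesis
    using fact_le_power[of m, where ?'a = nat] by simp
qed

theorem theorem1p2:
  shows "\<exists>c::real. 0 < c \<and>
    (\<exists>N::nat. \<forall>n\<ge>N. c * (ln (real n) / ln (ln (real n))) \<le> real (max_pierce_length n))"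
proof -
  have "eventually (\<lambda>n::nat. 1 < ln (ln (real n))) at_top"
    and "eventually (\<lambda>n::nat. 4 \<le> ln (real n) / ln (ln (real n))) at_top"
    by real_asymp+
  then have "eventually (\<lambda>n. 1 / 2 * (ln (real n) / ln (ln (real n)))
      \<le> real (max_pierce_length n)) at_top"
    using eventually_gt_at_top[of 0]
  proof eventually_elim
    case (elim n)
    define q where "q = ln (real n) / ln (ln (real n))"
    define m where "m = nat \<lfloor>q\<rfloor>"
    have q: "4 \<le> q"
      using elim(2) by (simp add: q_def)
    then have m: "real m \<le> q" "q < real m + 1"
      unfolding m_def by linarith+
    with q have "2 \<le> m"
      by linarith
    have "fact m < n"
      using elim(1,3) m(1) \<open>2 \<le> m\<close> by (intro fact_less_if_le_ln_div_ln_ln) (simp_all add: q_def)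
    with \<open>2 \<le> m\<close> have "m - 2 < max_pierce_length n"
      by (intro max_pierce_length_gt_if_fact_less) (simp only: le_add_diff_inverse2)
    \<comment> \<open>Hence \<open>P(n) \<ge> m - 1 > q - 2 \<ge> q/2\<close>, where the last step uses \<open>q \<ge> 4\<close>.\<close>
    then have "real m - 1 \<le> real (max_pierce_length n)"
      using \<open>2 \<le> m\<close> by linarith
    with m q have "1 / 2 * q \<le> real (max_pierce_length n)"
      by linarith
    then show ?case
      by (simp add: q_def)
  qed
  then have "\<exists>N. \<forall>n\<ge>N. 1 / 2 * (ln (real n) / ln (ln (real n))) \<le> real (max_pierce_length n)"
    by (simp only: eventually_at_top_linorder)
  then show ?thesis
    by (intro exI[of _ "1 / 2"]) simp
qed

end
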